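(* Let $(D,\sqsubseteq)$ be a finite partial ordering with least element $\bot$ and greatest element $\top$, and let $F$ be a finite set of inflationary and monotonic functions on $D$. Suppose the least common fixpoint $d_0$ of the functions in $F$ is computed by an execution of the RGI algorithm described in the context (with lists $\mathit{friends}(g,d)$, $\mathit{obviated}(g,d)$ satisfying condition ( * ) and $\mathit{update}$ satisfying (A), (B), (C)), and let $F_{\mathit{fin}}$ be the final value of the variable $F$ upon termination. Let $e\in D$ with $d_0\sqsubseteq e$. Then the least common fixpoint $\sqsupseteq e$ of the functions in $F$ coincides with the least common fixpoint $\sqsupseteq e$ of the functions in $F_{\mathit{fin}}$.
   Context: A function $f:D\to D$ is inflationary if $x\sqsubseteq f(x)$ for all $x$, and monotonic if $x\sqsubseteq y$ implies $f(x)\sqsubseteq f(y)$. RGI algorithm: $d:=\bot$; $F_0:=F$; $G:=F$; while $G\neq\emptyset$ and $d\neq\top$ do: choose $g\in G$; $G:=G-\{g\}$; $F:=F-(\mathit{friends}(g,d)\cup\mathit{obviated}(g,d))$; $G:=G-(\mathit{friends}(g,d)\cup\mathit{obviated}(g,d))$; $G:=G\cup\mathit{update}(G,h,d)$, where $\mathit{friends}(g,d)=[g_1,\ldots,g_k]$ and $h=g\circ g_1\circ\cdots\circ g_k$; $d:=h(d)$; end. Here for each $g\in F$, $d\in D$, $\mathit{friends}(g,d)$ and $\mathit{obviated}(g,d)$ are lists of functions from $F$ satisfying condition ( * ): for all $g\in F$, $d\in D$, with $\mathit{friends}(g,d)=[g_1,\ldots,g_k]$, every $f\in\mathit{friends}(g,d)\cup\mathit{obviated}(g,d)$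 satisfies $f(e)=e$ for all $e\sqsupseteq g\circ g_1\circ\cdots\circ g_k(d)$. And $\mathit{update}(G,h,d)$ is a subset of the current $F$ with: (A) $\{f\in F-G\mid f(d)=d\wedge f(h(d))\neq h(d)\}\subseteq\mathit{update}(G,h,d)$; (B) $h(d)=d$ implies $\mathit{update}(G,h,d)=\emptyset$; (C) $h(h(d))\neq h(d)$ implies $h\in\mathit{update}(G,h,d)$. *)

theory Defs
  imports Main
begin

definition inflationary :: "('a::order \<Rightarrow> 'a) \<Rightarrow> bool" where
  "inflationary f \<longleftrightarrow> (\<forall>x. x \<le> f x)"

definition common_fixpoint :: "('a \<Rightarrow> 'a) set \<Rightarrow> 'a \<Rightarrow> bool" where
  "common_fixpoint F x \<longleftrightarrow> (\<forall>f\<in>F. f x = x)"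

definition least_common_fixpoint :: "('a::order \<Rightarrow> 'a) set \<Rightarrow> 'a \<Rightarrow> bool" where
  "least_common_fixpoint F x \<longleftrightarrow>
     common_fixpoint F x \<and> (\<forall>y. common_fixpoint F y \<longrightarrow> x \<le> y)"

definition least_common_fixpoint_above :: "('a::order \<Rightarrow> 'a) set \<Rightarrow> 'a \<Rightarrow> 'a \<Rightarrow> bool" where
  "least_common_fixpoint_above F e x \<longleftrightarrow>
     common_fixpoint F x \<and> e \<le> x \<and> (\<forall>y. common_fixpoint F y \<and> e \<le> y \<longrightarrow> x \<le> y)"

type_synonym 'a fn_lists = "('a \<Rightarrow> 'a) \<Rightarrow> 'a \<Rightarrow> ('a \<Rightarrow> 'a) list"

text \<open>The composition $g \circ g_1 \circ \cdots \circ g_k$, where $[g_1, \ldots, g_k]$ is the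
  list of friends of $g$ at $d$.\<close>

definition with_friends :: "'a fn_lists \<Rightarrow> ('a \<Rightarrow> 'a) \<Rightarrow> 'a \<Rightarrow> ('a \<Rightarrow> 'a)" where
  "with_friends friends g d = g \<circ> foldr (\<circ>) (friends g d) id"

definition lists_from :: "('a \<Rightarrow> 'a) set \<Rightarrow> 'a fn_lists \<Rightarrow> bool" where
  "lists_from F l \<longleftrightarrow> (\<forall>g\<in>F. \<forall>d. set (l g d) \<subseteq> F)"

definition condition_star ::
    "('a::order \<Rightarrow> 'a) set \<Rightarrow> 'a fn_lists \<Rightarrow> 'a fn_lists \<Rightarrow> bool" where
  "condition_star F friends obviated \<longleftrightarrow>
     (\<forall>g\<in>F. \<forall>d. \<forall>f \<in> set (friends g d) \<union> set (obviated g d).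
        \<forall>e. with_friends friends g d d \<le> e \<longrightarrow> f e = e)"

text \<open>The requirements on \<open>U\<close>, the value of \<open>update\<close> at \<open>G\<close>, \<open>h\<close> and \<open>d\<close>, where \<open>F\<close> and \<open>G\<close>
  are the values of the program variables at the time \<open>update\<close> is called. The last three
  conjuncts are (A), (B) and (C).\<close>

definition update_conditions ::
    "('a \<Rightarrow> 'a) set \<Rightarrow> ('a \<Rightarrow> 'a) set \<Rightarrow> ('a \<Rightarrow> 'a) \<Rightarrow> 'a \<Rightarrow> ('a \<Rightarrow> 'a) set \<Rightarrow> bool" where
  "update_conditions F G h d U \<longleftrightarrow>
     U \<subseteq> F \<and>
     {f \<in> F - G. f d = d \<and> f (h d) \<noteq> h d} \<subseteq> U \<and>
     (h d = d \<longrightarrow> U = {}) \<and>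
     (h (h d) \<noteq> h d \<longrightarrow> h \<in> U)"

text \<open>A state \<open>(d, F, G)\<close> holds the current values of the three program variables;
  \<open>rgi_step\<close> is one execution of the loop body, including the loop guard. As the requirements on
  \<open>update\<close> refer to the current value of \<open>F\<close>, that value is an explicit first argument of
  \<open>update\<close>, and the requirements are imposed on the calls actually made.\<close>

inductive rgi_step ::
    "'a fn_lists \<Rightarrow> 'a fn_lists \<Rightarrow>
     (('a \<Rightarrow> 'a) set \<Rightarrow> ('a \<Rightarrow> 'a) set \<Rightarrow> ('a \<Rightarrow> 'a) \<Rightarrow> 'a \<Rightarrow> ('a \<Rightarrow> 'a) set) \<Rightarrow>
     'a::order_top \<times> ('a \<Rightarrow> 'a) set \<times> ('a \<Rightarrow> 'a) set \<Rightarrow>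
     'a \<times> ('a \<Rightarrow> 'a) set \<times> ('a \<Rightarrow> 'a) set \<Rightarrow> bool"
  for friends obviated update where
  "\<lbrakk> d \<noteq> top;
     g \<in> G;
     R = set (friends g d) \<union> set (obviated g d);
     F' = F - R;
     G' = (G - {g}) - R;
     h = with_friends friends g d;
     update_conditions F' G' h d (update F' G' h d) \<rbrakk>
   \<Longrightarrow> rgi_step friends obviated update (d, F, G) (h d, F', G' \<union> update F' G' h d)"

text \<open>\<open>rgi_computes friends obviated update F d F_fin\<close>: some execution started with the function
  set \<open>F\<close> terminates with \<open>d\<close> and \<open>F_fin\<close> as final values of the respective variables.\<close>

definition rgi_computes ::
    "'a fn_lists \<Rightarrow> 'a fn_lists \<Rightarrow>
     (('a \<Rightarrow> 'a) set \<Rightarrow> ('a \<Rightarrow> 'a) set \<Rightarrow> ('a \<Rightarrow> 'a) \<Rightarrow> 'a \<Rightarrow> ('a \<Rightarrow> 'a) set) \<Rightarrow>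
     ('a \<Rightarrow> 'a) set \<Rightarrow> 'a::{order_bot,order_top} \<Rightarrow> ('a \<Rightarrow> 'a) set \<Rightarrow> bool" where
  "rgi_computes friends obviated update F d F_fin \<longleftrightarrow>
     (\<exists>G. (rgi_step friends obviated update)\<^sup>*\<^sup>* (bot, F, F) (d, F_fin, G) \<and> (G = {} \<or> d = top))"

end

theory Submission
  imports Defs
begin

text \<open>By condition (*), a function discarded by the algorithm is the identity above the value that
  \<open>d\<close> takes in the same iteration. Since \<open>d\<close> only grows, every discarded function is the identity
  above \<open>d0\<close>. Hence \<open>F\<close> and \<open>F_fin\<close> have the same common fixpoints above \<open>e\<close>. The least one
  exists: the elements above \<open>e\<close> that lie below every common fixpoint above \<open>e\<close> form a set closed
  under \<open>F\<close>, and a maximal element of a closed set is fixed by all inflationary functions in \<open>F\<close>.\<close>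

lemma inflationaryD: "inflationary f \<Longrightarrow> x \<le> f x"
  by (simp add: inflationary_def)

lemma inflationary_id: "inflationary id"
  by (simp add: inflationary_def)

lemma inflationary_comp:
  assumes "inflationary f" "inflationary g"
  shows "inflationary (f \<circ> g)"
  unfolding inflationary_def
proof
  fix x
  have "x \<le> g x"
    using assms(2) by (rule inflationaryD)
  also have "\<dots> \<le> f (g x)"
    using assms(1) by (rule inflationaryD)
  finally show "x \<le> (f \<circ> g) x"
    by simp
qed

lemma inflationary_foldr_comp:
  "\<forall>f\<in>set fs. inflationary f \<Longrightarrow> inflationary (foldr (\<circ>) fs id)"
  by (induction fs) (simp_all add: inflationary_id inflationary_comp)

lemma inflationary_with_friends:
  assumes "inflationary g" "\<forall>f\<in>set (friends g d). inflationary f"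
  shows "inflationary (with_friends friends g d)"
  unfolding with_friends_def
  using assms by (intro inflationary_comp inflationary_foldr_comp)

lemma ex_common_fixpoint_in_closed_set:
  fixes S :: "'a::order set"
  assumes wfp: "wfp_on S (>)" and nonempty: "S \<noteq> {}"
    and inflationary: "\<forall>f\<in>F. inflationary f" and closed: "\<forall>f\<in>F. f ` S \<subseteq> S"
  shows "\<exists>x\<in>S. common_fixpoint F x"
proof -
  obtain x where "x \<in> S" and maximal: "\<And>y. x < y \<Longrightarrow> y \<notin> S"
    using wfp nonempty unfolding wfp_on_iff_ex_minimal by blast
  have "f x = x" if "f \<in> F" for f
  proof (rule ccontr)
    assume "f x \<noteq> x"
    then have "x < f x"
      using inflationary that inflationaryD[of f x] by (simp add: order_less_le)
    moreover have "f x \<in> S"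
      using closed that \<open>x \<in> S\<close> by blast
    ultimately show False
      using maximal by blast
  qed
  then show ?thesis
    using \<open>x \<in> S\<close> by (auto simp: common_fixpoint_def)
qed

lemma ex_least_common_fixpoint_above:
  fixes e :: "'a::order"
  assumes wfp: "wfp_on {e..} (>)"
    and inflationary: "\<forall>f\<in>F. inflationary f" and mono: "\<forall>f\<in>F. mono f"
  shows "\<exists>x. least_common_fixpoint_above F e x"
proof -
  define S where "S = {x. e \<le> x \<and> (\<forall>y. common_fixpoint F y \<and> e \<le> y \<longrightarrow> x \<le> y)}"
  have closed: "f x \<in> S" if "f \<in> F" "x \<in> S" for f x
  proof -
    have "e \<le> f x"
      using that inflationary inflationaryD[of f x] by (auto simp: S_def intro: order_trans)
    moreover have "f x \<le> y" if "common_fixpoint F y" "e \<le> y" for y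
    proof -
      have "f x \<le> f y"
        using that \<open>f \<in> F\<close> \<open>x \<in> S\<close> mono by (auto simp: S_def intro: monoD)
      also have "f y = y"
        using that \<open>f \<in> F\<close> by (simp add: common_fixpoint_def)
      finally show ?thesis .
    qed
    ultimately show ?thesis
      by (simp add: S_def)
  qed
  have "wfp_on S (>)"
    using wfp by (rule wfp_on_subset) (auto simp: S_def)
  moreover have "S \<noteq> {}"
    by (auto simp: S_def)
  ultimately obtain x where "x \<in> S" "common_fixpoint F x"
    using ex_common_fixpoint_in_closed_set[of S F] inflationary closed by blast
  then show ?thesis
    by (auto simp: S_def least_common_fixpoint_above_def)
qed

definition identity_above :: "'a::order \<Rightarrow> ('a \<Rightarrow> 'a) \<Rightarrow> bool" where
  "identity_above d f \<longleftrightarrow> (\<forall>x\<ge>d. f x = x)"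

lemma identity_above_mono: "d \<le> d' \<Longrightarrow> identity_above d f \<Longrightarrow> identity_above d' f"
  by (auto simp: identity_above_def)

lemma least_common_fixpoint_above_subset_eq:
  assumes "F' \<subseteq> F" "\<forall>f \<in> F - F'. identity_above e f"
  shows "least_common_fixpoint_above F' e = least_common_fixpoint_above F e"
proof -
  have "common_fixpoint F' y \<longleftrightarrow> common_fixpoint F y" if "e \<le> y" for y
    using assms that unfolding common_fixpoint_def identity_above_def by blast
  then show ?thesis
    unfolding least_common_fixpoint_above_def by blast
qed

lemma condition_star_identity_above:
  assumes "condition_star F friends obviated" "g \<in> F"
    and "f \<in> set (friends g d) \<union> set (obviated g d)"
  shows "identity_above (with_friends friends g d d) f"
  using assms by (simp add: condition_star_def identity_above_def)

definition rgi_invariant ::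
    "('a \<Rightarrow> 'a) set \<Rightarrow> 'a::order \<times> ('a \<Rightarrow> 'a) set \<times> ('a \<Rightarrow> 'a) set \<Rightarrow> bool" where
  "rgi_invariant F\<^sub>0 = (\<lambda>(d, F, G).
     G \<subseteq> F \<and> F \<subseteq> F\<^sub>0 \<and> (\<forall>f \<in> F\<^sub>0 - F. identity_above d f))"

lemma rgi_invariant_step:
  assumes inflationary: "\<forall>f\<in>F\<^sub>0. inflationary f"
    and friends: "lists_from F\<^sub>0 friends"
    and star: "condition_star F\<^sub>0 friends obviated"
    and step: "rgi_step friends obviated update s t"
    and invariant: "rgi_invariant F\<^sub>0 s"
  shows "rgi_invariant F\<^sub>0 t"
  using step
proof cases
  case loop_body: (1 d g G R F' F G' h)
  have "g \<in> F\<^sub>0" "G \<subseteq> F" "F \<subseteq> F\<^sub>0" and discarded: "\<And>f. f \<in> F\<^sub>0 - F \<Longrightarrow> identity_above d f"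
    using invariant loop_body by (auto simp: rgi_invariant_def)
  have "inflationary h"
    unfolding \<open>h = with_friends friends g d\<close>
    using inflationary friends \<open>g \<in> F\<^sub>0\<close> by (intro inflationary_with_friends) (auto simp: lists_from_def)
  then have "d \<le> h d"
    by (rule inflationaryD)
  have "identity_above (h d) f" if "f \<in> F\<^sub>0 - F'" for f
  proof (cases "f \<in> F")
    case True
    then have "f \<in> set (friends g d) \<union> set (obviated g d)"
      using that loop_body by blast
    then show ?thesis
      using condition_star_identity_above[OF star \<open>g \<in> F\<^sub>0\<close>] loop_body by blast
  next
    case False
    then show ?thesis
      using that discarded identity_above_mono[OF \<open>d \<le> h d\<close>] by blast
  qed
  moreover have "update F' G' h d \<subseteq> F'"
    using loop_body by (simp add: update_conditions_def)
  ultimately show ?thesis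
    using loop_body \<open>G \<subseteq> F\<close> \<open>F \<subseteq> F\<^sub>0\<close> by (auto simp: rgi_invariant_def)
qed

lemma rgi_computes_invariant:
  assumes "\<forall>f\<in>F. inflationary f" "lists_from F friends" "condition_star F friends obviated"
    and "rgi_computes friends obviated update F d F_fin"
  obtains G where "rgi_invariant F (d, F_fin, G)"
proof -
  obtain G where "(rgi_step friends obviated update)\<^sup>*\<^sup>* (bot, F, F) (d, F_fin, G)"
    using assms(4) by (auto simp: rgi_computes_def)
  then have "rgi_invariant F (d, F_fin, G)"
  proof (induction rule: rtranclp_induct)
    case base
    show ?case
      by (simp add: rgi_invariant_def)
  next
    case (step s t)
    show ?case
      using rgi_invariant_step[OF assms(1-3) step.hyps(2) step.IH] .
  qed
  then show ?thesis
    by (rule that)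
qed

theorem theorem4:
  fixes F F_fin :: "('a::{finite,order_bot,order_top} \<Rightarrow> 'a) set"
    and friends obviated :: "'a fn_lists"
    and update :: "('a \<Rightarrow> 'a) set \<Rightarrow> ('a \<Rightarrow> 'a) set \<Rightarrow> ('a \<Rightarrow> 'a) \<Rightarrow> 'a \<Rightarrow> ('a \<Rightarrow> 'a) set"
    and d0 e :: 'a
  assumes "finite F"
    and "\<forall>f\<in>F. inflationary f \<and> mono f"
    and "lists_from F friends"
    and "lists_from F obviated"
    and "condition_star F friends obviated"
    and "least_common_fixpoint F d0"
    and "rgi_computes friends obviated update F d0 F_fin"
    and "d0 \<le> e"
  shows "\<exists>x. least_common_fixpoint_above F e x \<and> least_common_fixpoint_above F_fin e x"
proof -
  obtain G where "rgi_invariant F (d0, F_fin, G)"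
    using assms(2,3,5,7) by (blast intro: rgi_computes_invariant)
  then have "F_fin \<subseteq> F" and "\<forall>f \<in> F - F_fin. identity_above d0 f"
    by (simp_all add: rgi_invariant_def)
  then have "least_common_fixpoint_above F_fin e = least_common_fixpoint_above F e"
    using identity_above_mono[OF \<open>d0 \<le> e\<close>]
    by (intro least_common_fixpoint_above_subset_eq) blast+
  moreover obtain x where "least_common_fixpoint_above F e x"
    using ex_least_common_fixpoint_above[of e F] assms(2)
    by (auto simp: strict_partial_order_wfp_on_finite_set)
  ultimately show ?thesis
    by auto
qed

end
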